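(* Let $a,b,c,d$ be four distinct points on the unit circle $S^1$ in the positive order. Let $w_4\in\mathbb{B}^2$ be the point of intersection of the hyperbolic lines $J^*[a,c]$ and $J^*[b,d]$. (i) Suppose that the lines $L(a,b)$ and $L(c,d)$ are not parallel, let $w_1$ be their intersection point, and let $$w_5=\frac{w_1}{|w_1|}\Big(|w_1|-\sqrt{|w_1|^2-1}\Big),$$ the midpoint of the arc in $\mathbb{B}^2$ of the circle with center $w_1$ orthogonal to the unit circle. If $|w_4|\neq|w_5|$ (so that $T_{w_4,w_5}$ is defined), then there exists a Möbius transformation $m_4:\mathbb{B}^2\to\mathbb{B}^2$ (onto) such that the quadruple $m_4(a),m_4(b),m_4(c),m_4(d)$ is symmetric with respect to a line through $0$ and $$\mathrm{Lip}(m_4)=\mathrm{Lip}(T_{w_4,w_5}).$$ (ii) If $m_5=T_{w_4}$, then $m_5(a)=-m_5(c)$ and $m_5(b)=-m_5(d)$.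
   Context: $\mathbb{B}^2$ is the open unit disk in $\mathbb{C}$ and $S^1$ its boundary circle. $L(x,y)$ is the Euclidean line through distinct points $x,y$. For distinct $x,y\in S^1$, $J^*[x,y]$ is the hyperbolic line of $\mathbb{B}^2$ with end points $x,y$: a diameter if $y=-x$, and otherwise the arc inside $\mathbb{B}^2$ of the circle through $x,y$ orthogonal to $S^1$. For $u\in\mathbb{B}^2$, $T_u(z)=\dfrac{z-u}{1-\overline{u}z}$. For $u,v\in\mathbb{B}^2\setminus\{0\}$ with $|u|\ne|v|$, $$T_{u,v}(z)=\frac{v}{\overline{v}}\,\frac{\overline{\gamma}z-1}{z-\gamma},\qquad \gamma=\frac{u-v+uv(\overline{u}-\overline{v})}{|u|^2-|v|^2},$$ which is a Möbius transformation of $\mathbb{B}^2$ onto itself with $T_{u,v}(u)=v$. Möbius transformations of $\mathbb{B}^2$ onto itself extend to $S^1$ in the natural way. For $f:\mathbb{B}^2\to\mathbb{B}^2$, $\mathrm{Lip}(f)=\sup\{|f(x)-f(y)|/|x-y| : x,y\in\mathbb{B}^2,\ x\ne y\}$ (Euclidean metric). A quadruple of points is symmetric with respect to a line if the reflection in the line maps the set of the four points onto itself. *)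

theory Defs
  imports "HOL-Complex_Analysis.Complex_Analysis"
begin

definition euclid_line :: "complex \<Rightarrow> complex \<Rightarrow> complex set" where
  "euclid_line x y = affine hull {x, y}"

(* Four points of the unit circle that are met in this order when the circle is
   traversed once counterclockwise; in particular they are distinct. *)
definition positive_order :: "complex \<Rightarrow> complex \<Rightarrow> complex \<Rightarrow> complex \<Rightarrow> bool" where
  "positive_order a b c d \<longleftrightarrow>
     (\<exists>\<alpha> \<beta> \<gamma> \<delta> :: real. \<alpha> < \<beta> \<and> \<beta> < \<gamma> \<and> \<gamma> < \<delta> \<and> \<delta> < \<alpha> + 2 * pi \<and>
        a = cis \<alpha> \<and> b = cis \<beta> \<and> c = cis \<gamma> \<and> d = cis \<delta>)"

(* Circles are orthogonal if they meet and their radii (equivalently, their tangents)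
   at every common point are perpendicular. *)
definition orthogonal_circles :: "complex \<Rightarrow> real \<Rightarrow> complex \<Rightarrow> real \<Rightarrow> bool" where
  "orthogonal_circles p r q s \<longleftrightarrow>
     sphere p r \<inter> sphere q s \<noteq> {} \<and>
     (\<forall>z \<in> sphere p r \<inter> sphere q s. orthogonal (z - p) (z - q))"

(* The hyperbolic line J*[x,y] for distinct x, y on the unit circle. For y \<noteq> - x there is
   exactly one circle through x and y orthogonal to the unit circle. *)
definition hyp_line :: "complex \<Rightarrow> complex \<Rightarrow> complex set" where
  "hyp_line x y =
     (if y = - x then open_segment x y
      else {z \<in> ball 0 1. \<exists>p r. r > 0 \<and> orthogonal_circles p r 0 1 \<and>
              x \<in> sphere p r \<and> y \<in> sphere p r \<and> z \<in> sphere p r})"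

definition T1 :: "complex \<Rightarrow> complex \<Rightarrow> complex" where
  "T1 u z = (z - u) / (1 - cnj u * z)"

lemma T1_eq_Moebius_function: "T1 u = Moebius_function 0 u"
  by (simp add: fun_eq_iff T1_def Moebius_function_def)

definition T2_gamma :: "complex \<Rightarrow> complex \<Rightarrow> complex" where
  "T2_gamma u v = (u - v + u * v * (cnj u - cnj v)) / of_real ((cmod u)\<^sup>2 - (cmod v)\<^sup>2)"

definition T2 :: "complex \<Rightarrow> complex \<Rightarrow> complex \<Rightarrow> complex" where
  "T2 u v z = v / cnj v * ((cnj (T2_gamma u v) * z - 1) / (z - T2_gamma u v))"

(* Moebius transformations of the unit disk onto itself, together with their natural
   extension to the unit circle: the values outside the closed disk are irrelevant. *)
definition moebius_disk :: "(complex \<Rightarrow> complex) \<Rightarrow> bool" where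
  "moebius_disk m \<longleftrightarrow>
     (\<exists>p q r s. p * s - q * r \<noteq> 0 \<and>
        (\<forall>z \<in> cball 0 1. r * z + s \<noteq> 0 \<and> m z = (p * z + q) / (r * z + s))) \<and>
     m ` ball 0 1 = ball 0 1"

(* The supremum is taken in the extended reals, so that it is meaningful for every f. *)
definition Lip :: "(complex \<Rightarrow> complex) \<Rightarrow> ereal" where
  "Lip f = Sup {ereal (cmod (f x - f y) / cmod (x - y)) | x y.
                  x \<in> ball 0 1 \<and> y \<in> ball 0 1 \<and> x \<noteq> y}"

(* closest_point L z is the foot of the perpendicular from z to the line L. *)
definition line_reflection :: "complex set \<Rightarrow> complex \<Rightarrow> complex" where
  "line_reflection L z = 2 * closest_point L z - z"

definition symmetric_wrt_line :: "complex set \<Rightarrow> complex set \<Rightarrow> bool" where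
  "symmetric_wrt_line L S \<longleftrightarrow> line_reflection L ` S = S"

end

theory Submission
  imports Defs
begin

text \<open>The map \<open>T\<^sub>u\<^sub>,\<^sub>v\<close> with \<open>u = w\<^sub>4\<close> and \<open>v = w\<^sub>5\<close> itself serves as \<open>m\<^sub>4\<close>. It is the inversion in the
  hyperbolic perpendicular bisector of \<open>u\<close> and \<open>v\<close>, whose centre is \<open>\<gamma>\<close>, followed by the reflection in
  the line through \<open>0\<close> and \<open>v\<close>. Inversion in the circle \<open>C\<close> centred at \<open>w\<^sub>1\<close> and orthogonal to the unit
  circle swaps \<open>a, b\<close> and swaps \<open>c, d\<close>, so it fixes \<open>w\<^sub>4\<close>; thus \<open>u\<close> and \<open>v\<close> both lie on \<open>C\<close>, and
  \<open>T\<^sub>u\<^sub>,\<^sub>v\<close> preserves \<open>C\<close>. After applying it, the half-turn about \<open>v\<close> swaps the images of \<open>a, c\<close> and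
  those of \<open>b, d\<close>, while inversion in \<open>C\<close> still swaps the images of \<open>a, b\<close> and those of \<open>c, d\<close>.
  The product of these two is the reflection in the line through \<open>0\<close> and \<open>w\<^sub>1\<close>.\<close>

section \<open>Euclidean and hyperbolic lines as polynomial equations\<close>

lemma cnj_mult_self_sphere:
  assumes "a \<in> sphere 0 1"
  shows "a * cnj a = 1"
  using assms by (simp add: complex_norm_square[symmetric])

lemma two_inner_complex: "of_real (2 * (x \<bullet> y)) = x * cnj y + cnj x * (y :: complex)"
  by (simp add: complex_eq_iff inner_complex_def algebra_simps)

lemma one_minus_cnj_mult_neq_0:
  assumes "cmod u < 1" "cmod a = 1"
  shows "1 - cnj u * a \<noteq> 0"
proof
  assume "1 - cnj u * a = 0"
  then have "cmod (cnj u * a) = 1"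
    by (metis eq_iff_diff_eq_0 norm_one)
  with assms show False by (simp add: norm_mult)
qed

text \<open>The equation is real-affine in \<open>w\<close> and holds at \<open>w = a\<close> and
  \<open>w = b\<close>, because \<open>a * cnj a = b * cnj b = 1\<close>. It thus also covers points
  of the line outside the disk, such as the centre of the circle used later.\<close>

lemma euclid_line_sphere_eq:
  assumes "a \<in> sphere 0 1" "b \<in> sphere 0 1" "w \<in> euclid_line a b"
  shows "w + a * b * cnj w = a + b"
proof -
  obtain s t :: real where st: "s + t = 1" and w: "w = s *\<^sub>R a + t *\<^sub>R b"
    using assms(3) by (auto simp: euclid_line_def affine_hull_2)
  have "complex_of_real s + of_real t = 1"
    using st by (metis of_real_1 of_real_add)
  moreover have "a * cnj a = 1" "b * cnj b = 1"
    using assms cnj_mult_self_sphere by auto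
  ultimately show ?thesis
    unfolding w by (simp add: scaleR_conv_of_real) algebra
qed

text \<open>The conclusion says that the half-turn of the hyperbolic plane about \<open>z\<close> swaps \<open>x\<close> and \<open>y\<close>.\<close>

lemma hyp_line_half_turn:
  assumes x: "x \<in> sphere 0 1" and y: "y \<in> sphere 0 1" and "x \<noteq> y" and z: "z \<in> hyp_line x y"
  shows "cmod z < 1" "(x - z) * (1 - cnj z * y) + (y - z) * (1 - cnj z * x) = 0"
proof -
  have xx: "x * cnj x = 1" and yy: "y * cnj y = 1"
    using x y cnj_mult_self_sphere by auto
  have "cmod z < 1 \<and> (x - z) * (1 - cnj z * y) + (y - z) * (1 - cnj z * x) = 0"
  proof (cases "y = - x")
    case True
    have zs: "z \<in> open_segment x (-x)" using z True by (simp add: hyp_line_def)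
    then obtain t where t: "0 < t" "t < 1" "z = (1 - t) *\<^sub>R x + t *\<^sub>R (- x)"
      by (auto simp: in_segment)
    then have zt: "z = of_real (1 - 2 * t) * x"
      by (simp add: scaleR_conv_of_real algebra_simps)
    have "cmod z = \<bar>1 - 2 * t\<bar>" unfolding zt norm_mult norm_of_real using x by simp
    then have "cmod z < 1" using t by simp
    moreover have "cnj z = of_real (1 - 2 * t) * cnj x" using zt by simp
    then have "(x - z) * (1 - cnj z * y) + (y - z) * (1 - cnj z * x) = 0"
      using xx zt True by algebra
    ultimately show ?thesis by blast
  next
    case False
    then obtain p r where zb: "cmod z < 1" and orth: "orthogonal_circles p r 0 1"
      and xp: "x \<in> sphere p r" and yp: "y \<in> sphere p r" and zp: "z \<in> sphere p r"
      using z by (auto simp: hyp_line_def)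
    \<comment> \<open>Orthogonality puts the centre \<open>p\<close> on the tangents to the unit
      circle at \<open>x\<close> and \<open>y\<close>, so \<open>p\<close> is the pole of the chord;
      \<open>q1\<close> and \<open>q2\<close> below express this.\<close>
    have inn: "(x - p) \<bullet> x = 0" "(y - p) \<bullet> y = 0"
      using orth xp yp x y by (auto simp: orthogonal_circles_def orthogonal_def)
    have p1: "p * cnj x + cnj p * x = 2"
      using inn(1) xx two_inner_complex[of "x - p" x] by (simp add: algebra_simps)
    have p2: "p * cnj y + cnj p * y = 2"
      using inn(2) yy two_inner_complex[of "y - p" y] by (simp add: algebra_simps)
    have "cmod (z - p) = cmod (x - p)"
      using xp zp by (simp add: dist_norm norm_minus_commute)
    then have p3: "(z - p) * cnj (z - p) = (x - p) * cnj (x - p)"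
      by (metis complex_norm_square)
    have px: "p + cnj p * x\<^sup>2 = 2 * x" 
    proof -
      have "p + cnj p * x\<^sup>2 = x * (p * cnj x + cnj p * x) + p * (1 - x * cnj x)" by algebra
      then show ?thesis using p1 xx by simp
    qed
    have py: "p + cnj p * y\<^sup>2 = 2 * y" 
    proof -
      have "p + cnj p * y\<^sup>2 = y * (p * cnj y + cnj p * y) + p * (1 - y * cnj y)" by algebra
      then show ?thesis using p2 yy by simp
    qed
    have "(x - y) * (cnj p * (x + y) - 2) = 0"
      using px py by algebra
    then have q1: "cnj p * (x + y) = 2" using \<open>x \<noteq> y\<close> by simp
    have q2: "p * (x + y) = 2 * x * y" 
    proof -
      have "p * (x + y) = (x + y) * (p + cnj p * x\<^sup>2) - x\<^sup>2 * (cnj p * (x + y))" by algebra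
      then show ?thesis unfolding px q1 by (simp add: algebra_simps power2_eq_square)
    qed
    \<comment> \<open>Eliminating the radius by means of \<open>x\<close> gives the equation of the
      circle about \<open>p\<close> orthogonal to the unit circle.\<close>
    have "z * cnj z + 1 - z * cnj p - cnj z * p
        = ((z - p) * cnj (z - p) - (x - p) * cnj (x - p)) + (x * cnj x - (p * cnj x + cnj p * x)) + 1"
      by (simp add: algebra_simps)
    then have p4: "z * cnj z + 1 - z * cnj p - cnj z * p = 0"
      unfolding p1 p3 xx by simp
    have "(x - z) * (1 - cnj z * y) + (y - z) * (1 - cnj z * x)
        = (x + y) * (z * cnj z + 1 - z * cnj p - cnj z * p)
          + z * (cnj p * (x + y) - 2) + cnj z * (p * (x + y) - 2 * x * y)"
      by algebra
    then have "(x - z) * (1 - cnj z * y) + (y - z) * (1 - cnj z * x) = 0"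
      unfolding p4 q1 q2 by simp
    with zb show ?thesis by blast
  qed
  then show "cmod z < 1" "(x - z) * (1 - cnj z * y) + (y - z) * (1 - cnj z * x) = 0"
    by blast+
qed

text \<open>The last assumption is \<open>T1 u a + T1 u c = 0\<close> with the denominators
  cleared.\<close>

lemma T1_antipodal:
  assumes "cmod u < 1" "cmod a = 1" "cmod c = 1"
    and "(a - u) * (1 - cnj u * c) + (c - u) * (1 - cnj u * a) = 0"
  shows "T1 u a = - T1 u c"
  using assms(4) one_minus_cnj_mult_neq_0[OF assms(1,2)] one_minus_cnj_mult_neq_0[OF assms(1,3)]
  unfolding T1_def by (simp add: field_simps)

lemma line_reflection_through_0:
  assumes "p \<noteq> 0"
  shows "line_reflection (euclid_line 0 p) z = p / cnj p * cnj z"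
proof -
  let ?L = "euclid_line 0 p"
  have L: "?L = range (\<lambda>t. of_real t * p)"
    by (auto simp: euclid_line_def affine_hull_2 scaleR_conv_of_real intro: exI[of _ "1 - _"])
  define s where "s = (z \<bullet> p) / (p \<bullet> p)"
  have pp: "p \<bullet> p \<noteq> 0" using assms by simp
  have "of_real s * p = closest_point ?L z"
  proof (rule closest_point_unique)
    show "convex ?L" "closed ?L"
      by (simp_all add: euclid_line_def affine_imp_convex)
    show "of_real s * p \<in> ?L" using L by blast
    show "\<forall>y\<in>?L. dist z (of_real s * p) \<le> dist z y"
    proof
      fix y assume "y \<in> ?L"
      then obtain t where y: "y = t *\<^sub>R p" using L by (auto simp: scaleR_conv_of_real)
      \<comment> \<open>Pythagoras: \<open>s *\<^sub>R p\<close> is the orthogonal projection of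
        \<open>z\<close> onto the line.\<close>
      have "(z - t *\<^sub>R p) \<bullet> (z - t *\<^sub>R p) = (z - s *\<^sub>R p) \<bullet> (z - s *\<^sub>R p) + (t - s)\<^sup>2 * (p \<bullet> p)"
        using pp by (simp add: s_def inner_diff_left inner_diff_right inner_commute field_simps power2_eq_square)
      then have "(z - s *\<^sub>R p) \<bullet> (z - s *\<^sub>R p) \<le> (z - t *\<^sub>R p) \<bullet> (z - t *\<^sub>R p)"
        by simp
      then show "dist z (of_real s * p) \<le> dist z y"
        by (simp add: y dist_norm norm_le scaleR_conv_of_real)
    qed
  qed
  from this[symmetric] have "line_reflection ?L z = of_real (2 * (z \<bullet> p)) / of_real (p \<bullet> p) * p - z"
    unfolding line_reflection_def s_def by simp
  also have "of_real (p \<bullet> p) = p * cnj p"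
    by (metis complex_norm_square power2_norm_eq_inner)
  finally show ?thesis
    unfolding two_inner_complex using assms by (simp add: field_simps)
qed

section \<open>Moebius maps with a prescribed pole, and what they preserve\<close>

lemma moebius_disk_outer_pole:
  assumes k: "cmod k = 1" and g: "1 < cmod g"
  shows "moebius_disk (\<lambda>z. k * ((cnj g * z - 1) / (z - g)))"
proof -
  have bnd: "cmod ((cnj h * z - 1) / (z - h)) < 1" if "cmod z < 1" "1 < cmod h" for z h
  proof -
    have "(cmod (z - h))\<^sup>2 - (cmod (cnj h * z - 1))\<^sup>2 = (1 - (cmod z)\<^sup>2) * ((cmod h)\<^sup>2 - 1)"
      unfolding cmod_power2 by (simp add: power2_eq_square algebra_simps)
    moreover have "(1 - (cmod z)\<^sup>2) * ((cmod h)\<^sup>2 - 1) > 0"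
      using that by (intro mult_pos_pos) (auto simp: power_less_one_iff one_less_power abs_square_less_1)
    ultimately have "(cmod (cnj h * z - 1))\<^sup>2 < (cmod (z - h))\<^sup>2" by simp
    then have "cmod (cnj h * z - 1) < cmod (z - h)"
      by (rule power2_less_imp_less) simp
    then show ?thesis by (simp add: norm_divide divide_less_eq)
  qed
  have gg: "g * cnj g \<noteq> 1"
    using g by (metis complex_mod_mult_cnj norm_one one_less_power zero_less_numeral less_irrefl)
  have k0: "k \<noteq> 0" using k by auto
  have "(\<lambda>z. k * ((cnj g * z - 1) / (z - g))) ` ball 0 1 = ball 0 1" (is "?f ` _ = _")
  proof (intro equalityI subsetI)
    fix y assume "y \<in> ?f ` ball 0 1"
    then show "y \<in> ball 0 1" using bnd[OF _ g] k by (auto simp: norm_mult simp del: times_divide_eq_right)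
  next
    fix y :: complex assume y: "y \<in> ball 0 1"
    define x where "x = y / k"
    have x: "cmod x < 1" using y k by (simp add: x_def norm_divide)
    \<comment> \<open>Solving for the preimage of \<open>x\<close> gives a map of the same form with
      pole \<open>cnj g\<close>; this is why \<open>bnd\<close> is stated for every
      \<open>h\<close>.\<close>
    define z where "z = (cnj (cnj g) * x - 1) / (x - cnj g)"
    have z: "cmod z < 1" unfolding z_def using bnd[OF x, of "cnj g"] g by simp
    have "x - cnj g \<noteq> 0" using x g by auto
    then have e: "z * (x - cnj g) = g * x - 1" by (simp add: z_def)
    have "z - g \<noteq> 0" using z g by auto
    moreover have "cnj g * z - 1 = x * (z - g)" using e by algebra
    ultimately have "(cnj g * z - 1) / (z - g) = x" by simp
    then have "?f z = y" using k0 by (simp add: x_def)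
    then show "y \<in> ?f ` ball 0 1" using z by force
  qed
  moreover have "(k * cnj g) * (- g) - (- k) * 1 \<noteq> 0"
  proof -
    have "(k * cnj g) * (- g) - (- k) * 1 = k * (1 - g * cnj g)" by algebra
    with gg k0 show ?thesis by simp
  qed
  moreover have "\<forall>z\<in>cball 0 1. 1 * z + - g \<noteq> 0 \<and>
      ?f z = ((k * cnj g) * z + - k) / (1 * z + - g)"
    using g by (auto simp: algebra_simps)
  ultimately show ?thesis unfolding moebius_disk_def by blast
qed

text \<open>Conjugating a half-turn by \<open>m\<close> gives the half-turn about
  \<open>m u\<close>. In formulas, both kinds of factors transform multiplicatively
  (\<open>d\<close> and \<open>e\<close>), so the new expression is \<open>?K\<close> times the old
  one.\<close>

lemma half_turn_moebius:
  fixes k g a c u :: complex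
  defines "m \<equiv> \<lambda>z. k * ((cnj g * z - 1) / (z - g))"
  assumes k: "k * cnj k = 1" and "a \<noteq> g" "c \<noteq> g" "u \<noteq> g"
    and eq: "(a - u) * (1 - cnj u * c) + (c - u) * (1 - cnj u * a) = 0"
  shows "(m a - m u) * (1 - cnj (m u) * m c) + (m c - m u) * (1 - cnj (m u) * m a) = 0"
proof -
  have ne: "a - g \<noteq> 0" "c - g \<noteq> 0" "u - g \<noteq> 0" "cnj u - cnj g \<noteq> 0"
    using assms(3-5) by (simp_all flip: complex_cnj_diff)
  have d: "m x - m u = k * (1 - g * cnj g) * (x - u) / ((x - g) * (u - g))" if "x - g \<noteq> 0" for x
    using that ne(3) unfolding m_def by (simp add: divide_simps) (simp add: algebra_simps)
  have e: "1 - cnj (m u) * m x = - (1 - g * cnj g) * (1 - cnj u * x) / ((cnj u - cnj g) * (x - g))"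
    if "x - g \<noteq> 0" for x
  proof -
    have "cnj (m u) * m x
        = (k * cnj k) * ((g * cnj u - 1) / (cnj u - cnj g) * ((cnj g * x - 1) / (x - g)))"
      by (simp add: m_def mult_ac)
    then show ?thesis
      unfolding k using that ne(4) by (simp add: divide_simps) (simp add: algebra_simps)
  qed
  let ?K = "- k * (1 - g * cnj g)\<^sup>2 / ((a - g) * (c - g) * (u - g) * (cnj u - cnj g))"
  have "(m a - m u) * (1 - cnj (m u) * m c) + (m c - m u) * (1 - cnj (m u) * m a)
      = ?K * ((a - u) * (1 - cnj u * c) + (c - u) * (1 - cnj u * a))"
    unfolding d[OF ne(1)] d[OF ne(2)] e[OF ne(1)] e[OF ne(2)]
    using ne by (simp add: divide_simps power2_eq_square) (simp add: algebra_simps)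
  then show ?thesis using eq by simp
qed

text \<open>The assumption on \<open>g\<close> and \<open>w\<close> says that the circles with centres \<open>g\<close> and \<open>w\<close> that are orthogonal
  to the unit circle are orthogonal to each other.\<close>

lemma collinear_moebius:
  fixes k g a b w :: complex
  defines "m \<equiv> \<lambda>z. k * ((cnj g * z - 1) / (z - g))"
  assumes k: "k * cnj w = w" and gw: "g * cnj w + cnj g * w = 2"
    and "a \<noteq> g" "b \<noteq> g" and eq: "w + a * b * cnj w = a + b"
  shows "w + m a * m b * cnj w = m a + m b"
proof -
  have ne: "a - g \<noteq> 0" "b - g \<noteq> 0" using assms by auto
  \<comment> \<open>Without the rotation \<open>k\<close>, the map is an inversion with centre
    \<open>g\<close> followed by conjugation. So \<open>A\<close> and \<open>B\<close> satisfy the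
    equation with \<open>cnj w\<close> in place of \<open>w\<close>, and \<open>k\<close> turns
    \<open>cnj w\<close> back into \<open>w\<close>.\<close>
  define A B where "A = (cnj g * a - 1) / (a - g)" and "B = (cnj g * b - 1) / (b - g)"
  have A: "A * (a - g) = cnj g * a - 1" and B: "B * (b - g) = cnj g * b - 1"
    using ne by (simp_all add: A_def B_def)
  have "(a - g) * (b - g) * (cnj w + A * B * w - (A + B))
      = cnj w * (a - g) * (b - g) + w * (cnj g * a - 1) * (cnj g * b - 1)
        - ((cnj g * a - 1) * (b - g) + (cnj g * b - 1) * (a - g))"
    unfolding A[symmetric] B[symmetric] by algebra
  also have "\<dots> = (1 - g * cnj g) * (w + a * b * cnj w - (a + b))
      + (g * cnj w + cnj g * w - 2) * (a * b * cnj g - (a + b) + g)"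
    by algebra
  also have "\<dots> = 0" using gw eq by simp
  finally have "cnj w + A * B * w = A + B" using ne by simp
  then have "w + (k * A) * (k * B) * cnj w = k * A + k * B" using k by algebra
  then show ?thesis by (simp add: m_def A_def B_def)
qed

section \<open>The circle with centre w1 through w4 and w5\<close>

lemma sum_prod_eq_imp:
  fixes a b c d :: "'a :: idom"
  assumes "a + b = c + d" "a * b = c * d"
  shows "a = c \<or> a = d"
proof -
  have "(a - c) * (a - d) = 0" using assms by algebra
  then show ?thesis by auto
qed

text \<open>Put \<open>e = 2 * u / (1 + u * cnj u)\<close>. Then \<open>ac\<close> becomes
  \<open>e + a * c * cnj e = a + c\<close>, and \<open>bd\<close> likewise, so for points of the
  unit circle \<open>e\<close> is where the chords \<open>ac\<close> and \<open>bd\<close> meet. The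
  conclusion says that \<open>e\<close> lies on the polar of \<open>w\<close>: diagonal points of a
  cyclic quadrilateral are conjugate.\<close>

lemma half_turn_center_on_circle:
  fixes a b c d u w :: complex
  assumes "distinct [a, b, c, d]"
    and ac: "(a - u) * (1 - cnj u * c) + (c - u) * (1 - cnj u * a) = 0"
    and bd: "(b - u) * (1 - cnj u * d) + (d - u) * (1 - cnj u * b) = 0"
    and ab: "w + a * b * cnj w = a + b" and cd: "w + c * d * cnj w = c + d"
  shows "u * cnj u + 1 = u * cnj w + cnj u * w"
proof -
  have "1 + u * cnj u = of_real (1 + (cmod u)\<^sup>2)" by (simp only: of_real_add of_real_1 complex_norm_square)
  also have "\<dots> \<noteq> 0" by (metis of_real_eq_0_iff add_pos_nonneg zero_less_one zero_le_power2 less_irrefl)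
  finally have Q: "1 + u * cnj u \<noteq> 0" .
  have ne1: "a * b \<noteq> c * d"
    using sum_prod_eq_imp[of a b c d] assms(1) ab cd by auto
  have ne2: "a * c \<noteq> b * d"
  proof
    assume eq: "a * c = b * d"
    then have "(1 + u * cnj u) * (a + c) = (1 + u * cnj u) * (b + d)" using ac bd by algebra
    then have "a + c = b + d" using Q by simp
    then show False using sum_prod_eq_imp[OF _ eq] assms(1) by auto
  qed
  have 1: "2 * cnj u * (a * c - b * d) = (a + c - b - d) * (1 + u * cnj u)"
    using ac bd by algebra
  have 2: "2 * u * (b * d - a * c) = (b * d * (a + c) - a * c * (b + d)) * (1 + u * cnj u)"
    using ac bd by algebra
  have 3: "cnj w * (a * b - c * d) = a + b - c - d" using ab cd by algebra
  have 4: "w * (c * d - a * b) = c * d * (a + b) - a * b * (c + d)" using ab cd by algebra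
  \<comment> \<open>The two factors, nonzero by \<open>ne1\<close> and \<open>ne2\<close>, allow
    \<open>u\<close>, \<open>w\<close> and their conjugates to be eliminated by the four equations
    above.\<close>
  have "2 * (a * c - b * d) * (a * b - c * d) * (u * cnj u + 1 - (u * cnj w + cnj u * w))
     = 2 * (a * c - b * d) * (a * b - c * d) * (1 + u * cnj u)
       + (2 * u * (b * d - a * c)) * (cnj w * (a * b - c * d))
       + (2 * cnj u * (a * c - b * d)) * (w * (c * d - a * b))" by algebra
  also have "\<dots> = 0" unfolding 1 2 3 4 by algebra
  finally show ?thesis using ne1 ne2 by simp
qed

text \<open>By Cauchy-Schwarz, \<open>cmod w \<le> 1\<close> would force
  \<open>(1 - cmod u)\<^sup>2 \<le> 0\<close>.\<close>

lemma norm_center_gt_1: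
  assumes "cmod u < 1" and eq: "u * cnj u + 1 = u * cnj w + cnj u * w"
  shows "1 < cmod w"
proof -
  have "of_real ((cmod u)\<^sup>2 + 1) = complex_of_real (2 * (u \<bullet> w))"
    unfolding two_inner_complex eq[symmetric] by (simp only: of_real_add of_real_1 complex_norm_square)
  then have "(cmod u)\<^sup>2 + 1 = 2 * (u \<bullet> w)" using of_real_eq_iff by blast
  also have "\<dots> \<le> 2 * (cmod u * cmod w)" using norm_cauchy_schwarz[of u w] by simp
  finally have *: "(cmod u)\<^sup>2 + 1 \<le> 2 * (cmod u * cmod w)" .
  show ?thesis
  proof (rule ccontr)
    assume "\<not> 1 < cmod w"
    then have "cmod u * cmod w \<le> cmod u" by (simp add: mult_left_le)
    with * have "(1 - cmod u)\<^sup>2 \<le> 0" by (simp add: power2_eq_square algebra_simps)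
    then show False using assms(1) by simp
  qed
qed

text \<open>The modulus of \<open>v\<close> is the smaller root of
  \<open>x\<^sup>2 - 2 * cmod w * x + 1 = 0\<close>, which is the equation of the orthogonal circle
  restricted to the ray from 0 through \<open>w\<close>.\<close>

lemma arc_midpoint:
  assumes w: "1 < cmod w"
    and v: "v = w / of_real (cmod w) * of_real (cmod w - sqrt ((cmod w)\<^sup>2 - 1))"
  shows "v \<noteq> 0" "cmod v < 1" "v / cnj v = w / cnj w" "v * cnj v + 1 = v * cnj w + cnj v * w"
    and "v * cnj w = cnj v * w"
proof -
  define s where "s = sqrt ((cmod w)\<^sup>2 - 1)"
  define x where "x = cmod w - s"
  have ww: "1 < (cmod w)\<^sup>2" using w by (simp add: one_less_power)
  then have s2: "s\<^sup>2 = (cmod w)\<^sup>2 - 1" and s0: "0 < s" by (simp_all add: s_def)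
  have "s < cmod w" using s2 by (intro power2_less_imp_less[of s]) auto
  then have x0: "0 < x" by (simp add: x_def)
  \<comment> \<open>The other root exceeds 1, so \<open>x\<close> is below 1.\<close>
  have "x * (cmod w + s) = 1" using s2 by (simp add: x_def power2_eq_square algebra_simps)
  then have x1: "x < 1" using w s0 mult_right_mono[of 1 x "cmod w + s"] by (cases "x < 1") auto
  have xq: "x\<^sup>2 + 1 = 2 * x * cmod w"
    using s2 by (simp add: x_def power2_eq_square algebra_simps)
  have v: "v = of_real (x / cmod w) * w" by (simp add: v x_def s_def)
  have w0: "w \<noteq> 0" using w by auto
  show "v \<noteq> 0" using v w0 x0 by simp
  have nv: "cmod v = x" unfolding v norm_mult norm_of_real using w0 x0 by simp
  with x1 show "cmod v < 1" by simp
  show "v / cnj v = w / cnj w" using w0 x0 by (simp add: v)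
  show "v * cnj w = cnj v * w" by (simp add: v)
  have "v * cnj w + cnj v * w = of_real (2 * x / cmod w) * (w * cnj w)"
    by (simp add: v algebra_simps)
  also have "\<dots> = of_real (2 * x / cmod w * (cmod w)\<^sup>2)"
    by (simp only: of_real_mult complex_norm_square)
  also have "2 * x / cmod w * (cmod w)\<^sup>2 = x\<^sup>2 + 1"
    using w0 xq by (simp add: power2_eq_square)
  also have "of_real (x\<^sup>2 + 1) = v * cnj v + 1"
    unfolding nv[symmetric] by (simp only: of_real_add of_real_1 complex_norm_square)
  finally show "v * cnj v + 1 = v * cnj w + cnj v * w" by simp
qed

section \<open>The pole of \<open>T2 u v\<close>\<close>

lemma T2_gamma_mult:
  assumes "cmod u \<noteq> cmod v"
  shows "T2_gamma u v * (u * cnj u - v * cnj v) = u - v + u * v * (cnj u - cnj v)"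
    and "cnj (T2_gamma u v) * (u * cnj u - v * cnj v) = cnj u - cnj v + cnj u * cnj v * (u - v)"
    and "u * cnj u - v * cnj v \<noteq> 0"
proof -
  have D: "of_real ((cmod u)\<^sup>2 - (cmod v)\<^sup>2) = u * cnj u - v * cnj v"
    by (simp only: of_real_diff complex_norm_square)
  have "(cmod u)\<^sup>2 - (cmod v)\<^sup>2 \<noteq> 0" using assms by simp
  then show D0: "u * cnj u - v * cnj v \<noteq> 0" unfolding D[symmetric] of_real_eq_0_iff .
  show 1: "T2_gamma u v * (u * cnj u - v * cnj v) = u - v + u * v * (cnj u - cnj v)"
    unfolding T2_gamma_def D using D0 by simp
  from arg_cong[OF 1, of cnj]
  show "cnj (T2_gamma u v) * (u * cnj u - v * cnj v) = cnj u - cnj v + cnj u * cnj v * (u - v)"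
    by (simp add: mult.commute)
qed

lemma norm_T2_gamma_gt_1:
  assumes "cmod u \<noteq> cmod v" "cmod u < 1" "cmod v < 1"
  shows "1 < cmod (T2_gamma u v)"
proof -
  define g where "g = T2_gamma u v"
  note G = T2_gamma_mult[OF assms(1), folded g_def]
  \<comment> \<open>The right side is positive for distinct \<open>u\<close>, \<open>v\<close> in
    the disk, which forces the pole outside the closed disk.\<close>
  have "(g * cnj g - 1) * (u * cnj u - v * cnj v)\<^sup>2
      = (u - v) * cnj (u - v) * (1 - u * cnj u) * (1 - v * cnj v)"
    using G(1,2) unfolding complex_cnj_diff by algebra
  then have "of_real (((cmod g)\<^sup>2 - 1) * ((cmod u)\<^sup>2 - (cmod v)\<^sup>2)\<^sup>2)
      = complex_of_real ((cmod (u - v))\<^sup>2 * (1 - (cmod u)\<^sup>2) * (1 - (cmod v)\<^sup>2))"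
    unfolding complex_norm_square[symmetric]
    by (simp only: of_real_1[where 'a = complex, symmetric] flip: of_real_mult of_real_diff of_real_power)
  then have "((cmod g)\<^sup>2 - 1) * ((cmod u)\<^sup>2 - (cmod v)\<^sup>2)\<^sup>2
      = (cmod (u - v))\<^sup>2 * (1 - (cmod u)\<^sup>2) * (1 - (cmod v)\<^sup>2)"
    using of_real_eq_iff by blast
  also have "\<dots> > 0"
    using assms by (intro mult_pos_pos) (auto simp: abs_square_less_1)
  finally have "0 < (cmod g)\<^sup>2 - 1" by (simp add: zero_less_mult_iff)
  then have "1\<^sup>2 < (cmod g)\<^sup>2" by simp
  then show ?thesis unfolding g_def by (rule power2_less_imp_less) simp
qed

lemma T2_maps:
  assumes "cmod u \<noteq> cmod v" "cmod u < 1" "cmod v < 1" "v \<noteq> 0"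
  shows "T2 u v u = v"
proof -
  define g where "g = T2_gamma u v"
  note G = T2_gamma_mult[OF assms(1), folded g_def]
  have ug: "u - g \<noteq> 0" using norm_T2_gamma_gt_1[OF assms(1-3)] assms(2) by (auto simp: g_def)
  \<comment> \<open>The second factor vanishes exactly when the inversion with centre
    \<open>g\<close> sends \<open>u\<close> to \<open>v\<close>, written in conjugated form.\<close>
  have "(u * cnj u - v * cnj v) * (cnj g * u - 1 - cnj v * (u - g)) = 0"
    using G(1,2) by algebra
  then have "cnj g * u - 1 = cnj v * (u - g)" using G(3) by simp
  then show ?thesis using ug assms(4) by (simp add: T2_def flip: g_def)
qed

text \<open>The inversion with centre \<gamma> swaps \<open>u\<close> and \<open>v\<close>, so the
  product of their distances from \<gamma> is \<open>|\<gamma>|^2 - 1\<close>. Since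
  \<open>u\<close> and \<open>v\<close> lie on the circle about \<open>w\<close>, this is also the
  power \<open>|\<gamma>|^2 - 2 Re (\<gamma> * cnj w) + 1\<close> of \<gamma>.\<close>

lemma T2_gamma_orthogonal:
  assumes "cmod u \<noteq> cmod v"
    and u: "u * cnj u + 1 = u * cnj w + cnj u * w" and v: "v * cnj v + 1 = v * cnj w + cnj v * w"
  shows "T2_gamma u v * cnj w + cnj (T2_gamma u v) * w = 2"
proof -
  note G = T2_gamma_mult[OF assms(1)]
  have "(u * cnj u - v * cnj v) * (T2_gamma u v * cnj w + cnj (T2_gamma u v) * w - 2) = 0"
    using G(1,2) u v by algebra
  then show ?thesis using G(3) by simp
qed

section \<open>Symmetry of the image quadruple\<close>

lemma reflection_swaps:
  fixes A C D v w :: complex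
  assumes v: "v * cnj v + 1 = v * cnj w + cnj v * w" and vw: "v * cnj w = cnj v * w"
    and w: "1 < cmod w" and v0: "v \<noteq> 0" and A: "cmod A = 1"
    and AC: "(A - v) * (1 - cnj v * C) + (C - v) * (1 - cnj v * A) = 0"
    and CD: "w + C * D * cnj w = C + D"
  shows "D = w / cnj w * cnj A"
proof -
  have AA: "A * cnj A = 1" using A cnj_mult_self_sphere by simp
  have w0: "w \<noteq> 0" "cnj w \<noteq> 0" using w by auto
  have wA: "w - A \<noteq> 0" using w A by auto
  have ww: "1 - w * cnj w \<noteq> 0"
    using w by (metis complex_mod_mult_cnj norm_one one_less_power zero_less_numeral less_irrefl
      eq_iff_diff_eq_0)
  \<comment> \<open>By \<open>v\<close> and \<open>vw\<close> the centre \<open>v\<close> drops out: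
    the half-turn is the reflection in the line through 0 and \<open>w\<close> followed by the
    inversion about \<open>w\<close>, and \<open>CD\<close> then undoes the inversion.\<close>
  have "2 * cnj v * ((w - A) * C * cnj w - w * (1 - A * cnj w)) = 0"
    using AC v vw by algebra
  then have C: "(w - A) * C * cnj w = w * (1 - A * cnj w)" using v0 by simp
  have "(1 - w * cnj w) * (A * D * cnj w - w) = 0"
    using C CD by algebra
  then have "A * D * cnj w = w" using ww by simp
  then have "w * cnj A = (A * cnj A) * (D * cnj w)" by (simp add: mult_ac)
  then have "D * cnj w = w * cnj A" unfolding AA by simp
  then show ?thesis using w0 by (simp add: field_simps)
qed

lemma norm_moebius_sphere:
  assumes "cmod k = 1" "1 < cmod g" "cmod a = 1"
  shows "cmod (k * ((cnj g * a - 1) / (a - g))) = 1"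
proof -
  have aa: "a * cnj a = 1" using assms(3) cnj_mult_self_sphere by simp
  have "cnj g * a - 1 = - a * cnj (a - g)" using aa unfolding complex_cnj_diff by algebra
  then have "cmod (cnj g * a - 1) = cmod (a - g)"
    using assms(3) by (metis complex_mod_cnj mult_1 norm_minus_cancel norm_mult)
  moreover have "a \<noteq> g" using assms by auto
  ultimately show ?thesis using assms(1) by (simp add: norm_mult norm_divide)
qed

lemma T2_quadruple_symmetric:
  fixes a b c d u v w :: complex
  assumes sph: "{a, b, c, d} \<subseteq> sphere 0 1" and dist: "distinct [a, b, c, d]"
    and u: "cmod u < 1"
    and ac: "(a - u) * (1 - cnj u * c) + (c - u) * (1 - cnj u * a) = 0"
    and bd: "(b - u) * (1 - cnj u * d) + (d - u) * (1 - cnj u * b) = 0"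
    and ab: "w + a * b * cnj w = a + b" and cd: "w + c * d * cnj w = c + d"
    and v: "v = w / of_real (cmod w) * of_real (cmod w - sqrt ((cmod w)\<^sup>2 - 1))"
    and uv: "cmod u \<noteq> cmod v"
  shows "moebius_disk (T2 u v)"
    and "w \<noteq> 0" "symmetric_wrt_line (euclid_line 0 w) {T2 u v a, T2 u v b, T2 u v c, T2 u v d}"
proof -
  have uC: "u * cnj u + 1 = u * cnj w + cnj u * w"
    by (rule half_turn_center_on_circle[OF dist ac bd ab cd])
  have w1: "1 < cmod w" by (rule norm_center_gt_1[OF u uC])
  then show w0: "w \<noteq> 0" by auto
  note V = arc_midpoint[OF w1 v]
  define g where "g = T2_gamma u v"
  define k where "k = v / cnj v"
  have k: "cmod k = 1" using V(1) by (simp add: k_def norm_divide)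
  then have kk: "k * cnj k = 1" using cnj_mult_self_sphere by simp
  have kw: "k * cnj w = w" using V(3) w0 by (simp add: k_def)
  have g: "1 < cmod g" unfolding g_def by (rule norm_T2_gamma_gt_1[OF uv u V(2)])
  have T: "T2 u v = (\<lambda>z. k * ((cnj g * z - 1) / (z - g)))"
    by (simp add: fun_eq_iff T2_def k_def g_def)
  show "moebius_disk (T2 u v)" unfolding T by (rule moebius_disk_outer_pole[OF k g])
  have Tu: "T2 u v u = v" by (rule T2_maps[OF uv u V(2) V(1)])
  then have mu: "k * ((cnj g * u - 1) / (u - g)) = v" unfolding T .
  have gw: "g * cnj w + cnj g * w = 2"
    unfolding g_def by (rule T2_gamma_orthogonal[OF uv uC V(4)])
  have nrm: "cmod a = 1" "cmod b = 1" "cmod c = 1" "cmod d = 1" using sph by auto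
  have ne: "a \<noteq> g" "b \<noteq> g" "c \<noteq> g" "d \<noteq> g" "u \<noteq> g" using nrm g u by auto
  define A B C D where "A = T2 u v a" "B = T2 u v b" "C = T2 u v c" "D = T2 u v d"
  note ABCD = A_B_C_D_def
  have AC: "(A - v) * (1 - cnj v * C) + (C - v) * (1 - cnj v * A) = 0"
    using half_turn_moebius[OF kk ne(1,3,5) ac] unfolding ABCD T mu .
  have BD: "(B - v) * (1 - cnj v * D) + (D - v) * (1 - cnj v * B) = 0"
    using half_turn_moebius[OF kk ne(2,4,5) bd] unfolding ABCD T mu .
  have AB: "w + A * B * cnj w = A + B"
    using collinear_moebius[OF kw gw ne(1,2) ab] unfolding ABCD T .
  have CD: "w + C * D * cnj w = C + D"
    using collinear_moebius[OF kw gw ne(3,4) cd] unfolding ABCD T .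
  have N: "cmod A = 1" "cmod B = 1" "cmod C = 1" "cmod D = 1"
    unfolding ABCD T using norm_moebius_sphere[OF k g] nrm by blast+
  note S = reflection_swaps[OF V(4,5) w1 V(1)]
  \<comment> \<open>The half-turn pairs \<open>A\<close> with \<open>C\<close> and \<open>B\<close>
    with \<open>D\<close>; the inversion pairs \<open>A\<close> with \<open>B\<close> and
    \<open>C\<close> with \<open>D\<close>. Hence the reflection pairs \<open>A\<close> with
    \<open>D\<close> and \<open>B\<close> with \<open>C\<close>.\<close>
  have "D = w / cnj w * cnj A" by (rule S[OF N(1) AC CD])
  moreover have "C = w / cnj w * cnj B"
    using S[OF N(2) BD, of C] CD by (simp add: algebra_simps)
  moreover have "B = w / cnj w * cnj C"
    using S[OF N(3), of A B] AC AB by (simp add: algebra_simps)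
  moreover have "A = w / cnj w * cnj D"
    using S[OF N(4), of B A] BD AB by (simp add: algebra_simps)
  ultimately have R: "line_reflection (euclid_line 0 w) A = D"
      "line_reflection (euclid_line 0 w) B = C" "line_reflection (euclid_line 0 w) C = B"
      "line_reflection (euclid_line 0 w) D = A"
    by (simp_all only: line_reflection_through_0[OF w0])
  show "symmetric_wrt_line (euclid_line 0 w) {T2 u v a, T2 u v b, T2 u v c, T2 u v d}"
    unfolding symmetric_wrt_line_def ABCD[symmetric] image_insert image_empty R by blast
qed

theorem theorem6p2:
  fixes a b c d w4 :: complex
  assumes "{a, b, c, d} \<subseteq> sphere 0 1" and "distinct [a, b, c, d]"
    and "positive_order a b c d"
    and "w4 \<in> hyp_line a c \<inter> hyp_line b d"
  shows "(\<forall>w1 w5. \<not> affine_parallel (euclid_line a b) (euclid_line c d)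
            \<and> w1 \<in> euclid_line a b \<inter> euclid_line c d
            \<and> w5 = w1 / of_real (cmod w1) * of_real (cmod w1 - sqrt ((cmod w1)\<^sup>2 - 1))
            \<and> cmod w4 \<noteq> cmod w5
          \<longrightarrow> (\<exists>m4. moebius_disk m4
                \<and> (\<exists>p. p \<noteq> 0 \<and> symmetric_wrt_line (euclid_line 0 p) {m4 a, m4 b, m4 c, m4 d})
                \<and> Lip m4 = Lip (T2 w4 w5)))
       \<and> (\<forall>m5. m5 = T1 w4 \<longrightarrow> m5 a = - m5 c \<and> m5 b = - m5 d)"
proof -
  have sph: "a \<in> sphere 0 1" "b \<in> sphere 0 1" "c \<in> sphere 0 1" "d \<in> sphere 0 1"
    using assms(1) by auto
  have ne: "a \<noteq> c" "b \<noteq> d" using assms(2) by auto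
  note ac = hyp_line_half_turn[OF sph(1,3) ne(1) IntD1[OF assms(4)]]
  note bd = hyp_line_half_turn[OF sph(2,4) ne(2) IntD2[OF assms(4)]]
  \<comment> \<open>With \<open>m4 = T2 w4 w5\<close> and \<open>p = w1\<close> the
    \<open>Lip\<close> equation is reflexivity.\<close>
  have "\<exists>m4. moebius_disk m4
      \<and> (\<exists>p. p \<noteq> 0 \<and> symmetric_wrt_line (euclid_line 0 p) {m4 a, m4 b, m4 c, m4 d})
      \<and> Lip m4 = Lip (T2 w4 w5)"
    if "w1 \<in> euclid_line a b \<inter> euclid_line c d"
      and "w5 = w1 / of_real (cmod w1) * of_real (cmod w1 - sqrt ((cmod w1)\<^sup>2 - 1))"
      and "cmod w4 \<noteq> cmod w5" for w1 w5
    using T2_quadruple_symmetric[OF assms(1,2) ac(1,2) bd(2)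
        euclid_line_sphere_eq[OF sph(1,2) IntD1[OF that(1)]]
        euclid_line_sphere_eq[OF sph(3,4) IntD2[OF that(1)]] that(2,3)] by blast
  moreover have "T1 w4 a = - T1 w4 c" "T1 w4 b = - T1 w4 d"
    using T1_antipodal ac bd sph by auto
  ultimately show ?thesis by blast
qed

end
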